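(* Let $\kappa$ be a cardinal and let $\langle X_\alpha:\alpha<\kappa\rangle$ be $T_0$ topological spaces. If $\max(\log(\kappa),\sup\{\operatorname{ps}(X_\alpha):\alpha<\kappa\})$ is infinite, then $$\operatorname{ps}\Big(\sum_{\alpha<\kappa}X_\alpha\Big)=\max\big(\log(\kappa),\sup\{\operatorname{ps}(X_\alpha):\alpha<\kappa\}\big),$$ where $\sum_{\alpha<\kappa}X_\alpha$ is the topological sum (disjoint union).
   Context: Point separating game $G_\beta(X)$ ($X$ a topological space, $\beta$ an ordinal): two players, Seeker and Hider, make $\beta$ moves. At move $\alpha<\beta$, knowing all previous moves, the Seeker chooses an open set $U_\alpha\subseteq X$, and then the Hider chooses $V_\alpha\in\{U_\alpha, X\setminus U_\alpha\}$. The outcome is $W=\bigcap_{\alpha<\beta}V_\alpha$ (with $W=X$ if $\beta=0$). The Seeker wins iff $|W|\le 1$. For a $T_0$ space $X$, $\operatorname{ps}(X)$ is the least ordinal $\beta$ such that the Seeker has a winning strategy in $G_\beta(X)$. For a cardinal $\kappa$, $\log(\kappa)=\min\{\lambda:2^\lambda\ge\kappa\}$ (minimum over cardinals). The max and sup are taken among ordinals.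
   Formalization: The spaces X_α are assumed nonempty; otherwise the claim fails, e.g. for κ = ω and all X_α empty, where the sum has ps = 0 but log(κ) = ω is infinite. *)

theory Defs
  imports "HOL-Analysis.Analysis"
begin

unbundle cardinal_syntax

text \<open>
  Ordinals are represented by well-orders \<open>r\<close> (\<open>Well_order r\<close>), compared by the relations
  \<open>\<le>o\<close>, \<open><o\<close>, \<open>=o\<close>; an ordinal is thus given up to \<open>=o\<close>.  The ordinals below \<open>r\<close> are
  the elements of \<open>Field r\<close>, and \<open>underS r \<alpha>\<close> is the set of ordinals below \<open>\<alpha>\<close>.
\<close>

subsection \<open>Least ordinals, suprema, maxima, logarithms\<close>

text \<open>
  An ordinal smaller than \<open>r\<close> is isomorphic to an initial segment of \<open>r\<close>, hence is represented
  on the type carrying \<open>r\<close>.  So for a property invariant under \<open>=o\<close>, an ordinal that is least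
  among those represented on one type is least among all ordinals (lemma \<open>least_ord_le\<close>).
  The carrier types chosen below are large enough for the required ordinals to exist on them
  (lemmas \<open>ord_sup_is_sup\<close>, \<open>card_log_is_min\<close>, \<open>ps_wins\<close>).
\<close>

definition least_ord :: "('i rel \<Rightarrow> bool) \<Rightarrow> 'i rel" where
  "least_ord P = (SOME r. Well_order r \<and> P r \<and> (\<forall>s. Well_order s \<and> P s \<longrightarrow> r \<le>o s))"

definition ord_sup :: "'k set \<Rightarrow> ('k \<Rightarrow> 'i rel) \<Rightarrow> ('k \<times> 'i) rel" where
  "ord_sup I p = least_ord (\<lambda>r. \<forall>i\<in>I. p i \<le>o r)"

definition ord_max :: "'i rel \<Rightarrow> 'j rel \<Rightarrow> ('i + 'j) rel" where
  "ord_max r s = (if r \<le>o s then dir_image s Inr else dir_image r Inl)"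

definition card_log :: "'k rel \<Rightarrow> 'k rel" where
  "card_log \<kappa> = least_ord (\<lambda>l. Card_order l \<and> \<kappa> \<le>o ctwo ^c l)"

subsection \<open>The point separating game\<close>

text \<open>
  A strategy of the Seeker: the move at \<open>\<alpha>\<close> depends on the families of all earlier moves of the
  Seeker and of all earlier moves of the Hider.
\<close>

type_synonym ('i, 'a) strategy = "'i \<Rightarrow> ('i \<Rightarrow> 'a set) \<Rightarrow> ('i \<Rightarrow> 'a set) \<Rightarrow> 'a set"

definition seeker_strategy :: "'i rel \<Rightarrow> 'a topology \<Rightarrow> ('i, 'a) strategy \<Rightarrow> bool" where
  "seeker_strategy r X \<sigma> \<longleftrightarrow> (\<forall>\<alpha>\<in>Field r. \<forall>U V. openin X (\<sigma> \<alpha> U V))"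

definition play_of ::
  "'i rel \<Rightarrow> 'a topology \<Rightarrow> ('i, 'a) strategy \<Rightarrow> ('i \<Rightarrow> 'a set) \<Rightarrow> ('i \<Rightarrow> 'a set) \<Rightarrow> bool" where
  "play_of r X \<sigma> U V \<longleftrightarrow>
     (\<forall>\<alpha>\<in>Field r. U \<alpha> = \<sigma> \<alpha> (restrict U (underS r \<alpha>)) (restrict V (underS r \<alpha>)) \<and>
                 V \<alpha> \<in> {U \<alpha>, topspace X - U \<alpha>})"

definition outcome :: "'i rel \<Rightarrow> 'a topology \<Rightarrow> ('i \<Rightarrow> 'a set) \<Rightarrow> 'a set" where
  "outcome r X V = topspace X \<inter> (\<Inter>\<alpha>\<in>Field r. V \<alpha>)"

definition seeker_wins :: "'i rel \<Rightarrow> 'a topology \<Rightarrow> bool" where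
  "seeker_wins r X \<longleftrightarrow>
     (\<exists>\<sigma>. seeker_strategy r X \<sigma> \<and>
          (\<forall>U V. play_of r X \<sigma> U V \<longrightarrow> finite (outcome r X V) \<and> card (outcome r X V) \<le> 1))"

text \<open>
  Enumerating all pairs of points and separating each pair shows that every \<open>T\<^sub>0\<close> space has a
  winning strategy for some game length carried by pairs of points.
\<close>

definition ps :: "'a topology \<Rightarrow> ('a \<times> 'a) rel" where
  "ps X = least_ord (\<lambda>r. seeker_wins r X)"

subsection \<open>Adequacy\<close>

lemma least_ord_props:
  assumes "Well_order r" "P r"
  shows "Well_order (least_ord P)" "P (least_ord P)"
    "\<And>s. Well_order s \<Longrightarrow> P s \<Longrightarrow> least_ord P \<le>o s"
proof -
  have "\<exists>r\<in>{r. Well_order r \<and> P r}. \<forall>s\<in>{r. Well_order r \<and> P r}. r \<le>o s"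
    by (rule exists_minim_Well_order) (use assms in auto)
  then have "\<exists>r. Well_order r \<and> P r \<and> (\<forall>s. Well_order s \<and> P s \<longrightarrow> r \<le>o s)"
    by blast
  from someI_ex[OF this]
  show "Well_order (least_ord P)" "P (least_ord P)"
    "\<And>s. Well_order s \<Longrightarrow> P s \<Longrightarrow> least_ord P \<le>o s"
    unfolding least_ord_def by auto
qed

lemma least_ord_le:
  fixes P :: "'i rel \<Rightarrow> bool" and s :: "'j rel"
  assumes r: "Well_order r" "P r" and s: "Well_order s"
    and transfer: "\<And>t. s =o t \<Longrightarrow> P t"
  shows "least_ord P \<le>o s"
proof (rule ccontr)
  let ?l = "least_ord P"
  note l = least_ord_props[where P = P, OF r]
  assume "\<not> ?l \<le>o s"
  then have "s <o ?l"
    using l(1) s not_ordLeq_iff_ordLess by blast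
  then obtain a where a: "s =o Restr ?l (underS ?l a)"
    using ordLess_iff_ordIso_Restr[OF l(1) s] by blast
  have "?l \<le>o Restr ?l (underS ?l a)"
    using l(3)[OF Well_order_Restr[OF l(1)] transfer[OF a]] .
  with \<open>s <o ?l\<close> a show False
    by (meson not_ordLess_ordLeq ordIso_symmetric ordLeq_ordIso_trans)
qed

lemma seeker_wins_ordIso:
  fixes r :: "'i rel" and s :: "'j rel"
  assumes wins: "seeker_wins r X" and iso: "r =o s"
  shows "seeker_wins s X"
proof -
  from iso obtain f where wo: "Well_order r" "Well_order s" and f: "iso r s f"
    unfolding ordIso_def by blast
  have bij: "bij_betw f (Field r) (Field s)"
    using f by (simp add: iso_def)
  have cmp: "(f a, f b) \<in> s \<longleftrightarrow> (a, b) \<in> r" if "a \<in> Field r" "b \<in> Field r" for a b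
    using iso_forward[OF _ f] f wo that by (metis iso_iff2)
  have inj: "inj_on f (Field r)"
    using bij by (simp add: bij_betw_def)
  have und: "f a \<in> underS s (f b) \<longleftrightarrow> a \<in> underS r b" if "a \<in> Field r" "b \<in> Field r" for a b
    using that cmp inj by (auto simp: underS_def inj_on_def)
  define g where "g = inv_into (Field r) f"
  have g: "g (f a) = a" if "a \<in> Field r" for a
    using that inj by (simp add: g_def)
  from wins obtain \<sigma> where \<sigma>: "seeker_strategy r X \<sigma>"
    and win: "\<And>U V. play_of r X \<sigma> U V \<Longrightarrow> finite (outcome r X V) \<and> card (outcome r X V) \<le> 1"
    unfolding seeker_wins_def by blast
  define \<tau> :: "('j, 'a) strategy" where
    "\<tau> b U V = \<sigma> (g b) (restrict (U \<circ> f) (underS r (g b))) (restrict (V \<circ> f) (underS r (g b)))"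
    for b U V
  have "seeker_strategy s X \<tau>"
    using \<sigma> bij unfolding seeker_strategy_def \<tau>_def g_def
    by (metis bij_betw_apply bij_betw_inv_into)
  moreover have "finite (outcome s X V) \<and> card (outcome s X V) \<le> 1"
    if play: "play_of s X \<tau> U V" for U V
  proof -
    have restr: "restrict (restrict W (underS s (f a)) \<circ> f) (underS r a)
        = restrict (W \<circ> f) (underS r a)" if "a \<in> Field r" for a and W :: "'j \<Rightarrow> 'a set"
    proof (rule restrict_ext)
      fix b assume b: "b \<in> underS r a"
      then have "b \<in> Field r" by (auto simp: underS_def Field_def)
      then show "(restrict W (underS s (f a)) \<circ> f) b = (W \<circ> f) b"
        using und[OF _ that] b by simp
    qed
    have "play_of r X \<sigma> (U \<circ> f) (V \<circ> f)"
      unfolding play_of_def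
    proof
      fix a assume a: "a \<in> Field r"
      then have "f a \<in> Field s" using bij by (auto simp: bij_betw_def)
      then have "U (f a) = \<tau> (f a) (restrict U (underS s (f a))) (restrict V (underS s (f a)))"
        "V (f a) \<in> {U (f a), topspace X - U (f a)}"
        using play unfolding play_of_def by blast+
      then show "(U \<circ> f) a = \<sigma> a (restrict (U \<circ> f) (underS r a)) (restrict (V \<circ> f) (underS r a))
          \<and> (V \<circ> f) a \<in> {(U \<circ> f) a, topspace X - (U \<circ> f) a}"
        unfolding \<tau>_def g[OF a] restr[OF a] by simp
    qed
    moreover have "outcome r X (V \<circ> f) = outcome s X V"
      using bij_betw_imp_surj_on[OF bij] by (auto simp: outcome_def simp flip: bij_betw_imp_surj_on[OF bij])
    ultimately show ?thesis using win by metis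
  qed
  ultimately show ?thesis unfolding seeker_wins_def by blast
qed

lemma seeker_wins_pairs:
  fixes X :: "'a topology"
  assumes "t0_space X"
  shows "seeker_wins |UNIV :: ('a \<times> 'a) set| X"
proof -
  define sep where "sep = (\<lambda>(x, y) U. openin X U \<and>
    (x \<in> topspace X \<and> y \<in> topspace X \<and> x \<noteq> y \<longrightarrow> (x \<notin> U \<longleftrightarrow> y \<in> U)))"
  have "\<exists>U. sep z U" for z
    using assms openin_empty[of X] unfolding sep_def t0_space_def by (cases z) (simp only: prod.case, metis)
  then obtain S where S: "\<And>z. sep z (S z)" by metis
  let ?r = "|UNIV :: ('a \<times> 'a) set|"
  have "seeker_strategy ?r X (\<lambda>z U V. S z)"
    using S by (auto simp: seeker_strategy_def sep_def split: prod.splits)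
  moreover have "finite (outcome ?r X V) \<and> card (outcome ?r X V) \<le> 1"
    if play: "play_of ?r X (\<lambda>z U V. S z) U V" for U V
  proof -
    have V: "V z = S z \<or> V z = topspace X - S z" for z
      using play unfolding play_of_def Field_card_of by blast
    have "x = y" if "x \<in> outcome ?r X V" "y \<in> outcome ?r X V" for x y
      using that V[of "(x, y)"] S[of "(x, y)"] by (auto simp: outcome_def sep_def Field_card_of)
    then show ?thesis
      by (metis card.infinite card_le_Suc0_iff_eq One_nat_def finite.emptyI finite_insert
          finite_subset insertI1 subsetI zero_le)
  qed
  ultimately show ?thesis unfolding seeker_wins_def by blast
qed

lemma ps_wins:
  assumes "t0_space X"
  shows "Well_order (ps X)" "seeker_wins (ps X) X"
  using least_ord_props(1,2)[where P = "\<lambda>r. seeker_wins r X",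
      OF card_of_Well_order seeker_wins_pairs[OF assms]]
  unfolding ps_def by auto

lemma ps_least:
  fixes s :: "'j rel"
  assumes "t0_space X" "Well_order s" "seeker_wins s X"
  shows "ps X \<le>o s"
  unfolding ps_def
  by (rule least_ord_le[where P = "\<lambda>r. seeker_wins r X",
        OF card_of_Well_order seeker_wins_pairs[OF assms(1)] assms(2)])
    (rule seeker_wins_ordIso[OF assms(3)])

lemma card_log_is_min:
  fixes \<kappa> :: "'k rel" and l :: "'j rel"
  assumes "Card_order \<kappa>"
  shows "Card_order (card_log \<kappa>)" "\<kappa> \<le>o ctwo ^c (card_log \<kappa>)"
    "Card_order l \<Longrightarrow> \<kappa> \<le>o ctwo ^c l \<Longrightarrow> card_log \<kappa> \<le>o l"
proof -
  have w: "Well_order \<kappa>" and P: "Card_order \<kappa> \<and> \<kappa> \<le>o ctwo ^c \<kappa>"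
    using assms ordLess_ctwo_cexp[OF assms] ordLess_imp_ordLeq card_order_on_well_order_on by blast+
  show "Card_order (card_log \<kappa>)" "\<kappa> \<le>o ctwo ^c (card_log \<kappa>)"
    using least_ord_props(2)[where P = "\<lambda>l. Card_order l \<and> \<kappa> \<le>o ctwo ^c l", OF w P]
    unfolding card_log_def by auto
  assume l: "Card_order l" "\<kappa> \<le>o ctwo ^c l"
  show "card_log \<kappa> \<le>o l"
    unfolding card_log_def
  proof (rule least_ord_le[where P = "\<lambda>l. Card_order l \<and> \<kappa> \<le>o ctwo ^c l", OF w P])
    show "Well_order l" using l(1) card_order_on_well_order_on by blast
    fix t :: "'k rel" assume t: "l =o t"
    then have "Card_order t" using l(1) Card_order_ordIso2 by blast
    moreover have "ctwo ^c l =o ctwo ^c t"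
      using t l(1) \<open>Card_order t\<close> Card_order_ctwo by (intro cexp_cong2) auto
    ultimately show "Card_order t \<and> \<kappa> \<le>o ctwo ^c t"
      using l(2) ordLeq_ordIso_trans by blast
  qed
qed

lemma ord_max_props:
  assumes "Well_order r" "Well_order s"
  shows "r \<le>o s \<Longrightarrow> ord_max r s =o s" "s \<le>o r \<Longrightarrow> ord_max r s =o r"
proof -
  have i: "s =o dir_image s Inr" "r =o dir_image r Inl"
    using assms by (auto intro!: dir_image_ordIso)
  then show A: "r \<le>o s \<Longrightarrow> ord_max r s =o s"
    by (auto simp: ord_max_def intro: ordIso_symmetric)
  show "s \<le>o r \<Longrightarrow> ord_max r s =o r"
    using i A by (metis ord_max_def ordIso_iff_ordLeq ordIso_symmetric ordIso_transitive)
qed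

lemma Restr_ordLeq:
  assumes r: "Well_order r"
  shows "Restr r A \<le>o r"
proof (rule ccontr)
  let ?q = "Restr r A"
  have q: "Well_order ?q" using Well_order_Restr[OF r] .
  assume "\<not> ?q \<le>o r"
  then have "r <o ?q" using q r not_ordLeq_iff_ordLess by blast
  then obtain a where a: "a \<in> Field ?q" and "r =o Restr ?q (underS ?q a)"
    using ordLess_iff_ordIso_Restr[OF q r] by blast
  then obtain f where f: "iso r (Restr ?q (underS ?q a)) f"
    unfolding ordIso_def by blast
  have wf: "wf (r - Id)" and tr: "trans r" and re: "refl_on (Field r) r"
    using r by (auto simp: order_on_defs)
  have fin: "f b \<in> underS ?q a" if "b \<in> Field r" for b
    using bij_betw_apply[of f, OF _ that] f Field_Restr_subset[of ?q "underS ?q a"]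
    by (auto simp only: iso_def)
  have step: "(f (f b), f b) \<in> r - Id" if "(f b, b) \<in> r - Id" for b
  proof -
    have b: "b \<in> Field r" "f b \<in> Field r" using that by (auto simp: Field_def)
    then have "(f (f b), f b) \<in> r" using f that by (auto simp: iso_iff2)
    moreover have "f (f b) \<noteq> f b"
      using f b that by (auto simp: iso_def bij_betw_def inj_on_def)
    ultimately show ?thesis by blast
  qed
  have "(f b, b) \<notin> r - Id" for b
    using wf
  proof (induction b rule: wf_induct_rule)
    case (less b)
    then show ?case using step by blast
  qed
  moreover have "a \<in> Field r" using a by (auto simp: Field_def)
  ultimately show False using fin[of a] by (auto simp: underS_def)
qed

lemma upper_bound_exists:
  fixes p :: "'k \<Rightarrow> 'i rel"
  assumes "\<And>i. i \<in> I \<Longrightarrow> Well_order (p i)"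
  shows "\<exists>r :: ('k \<times> 'i) rel. Well_order r \<and> (\<forall>i\<in>I. p i \<le>o r)"
proof -
  define k where "k = |I|"
  have k: "Well_order k" "Field k = I"
    unfolding k_def by (rule card_of_Well_order, rule Field_card_of)
  define F where "F = Sigma I (\<lambda>i. Field (p i))"
  define r where "r = {((i, x), (j, y)). (i, x) \<in> F \<and> (j, y) \<in> F \<and>
    ((i, j) \<in> k - Id \<or> i = j \<and> (x, y) \<in> p i)}"
  have pp: "refl_on (Field (p i)) (p i)" "trans (p i)" "antisym (p i)" "total_on (Field (p i)) (p i)"
    "wf (p i - Id)" if "i \<in> I" for i
    using assms[OF that] by (auto simp: order_on_defs well_order_on_def)
  have kk: "refl_on (Field k) k" "trans k" "antisym k" "total_on (Field k) k" "wf (k - Id)"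
    using k(1) by (auto simp: order_on_defs well_order_on_def)
  have "(z, z) \<in> r" if "z \<in> F" for z
    using that pp(1) by (auto simp: r_def F_def refl_on_def)
  then have Fr: "Field r = F"
    by (fastforce simp: r_def Field_def)
  have 1: "refl_on (Field r) r"
    using pp(1) unfolding Fr by (auto simp: r_def F_def refl_on_def)
  have 2: "trans r"
  proof (rule transI)
    fix a b c assume ab: "(a, b) \<in> r" and bc: "(b, c) \<in> r"
    obtain i x j y l z where [simp]: "a = (i, x)" "b = (j, y)" "c = (l, z)"
      by (metis surj_pair)
    have F: "a \<in> F" "c \<in> F" "i \<in> I"
      using ab bc by (auto simp: r_def F_def)
    consider "i = j" "j = l" "(x, y) \<in> p i" "(y, z) \<in> p i"
      | "(i, j) \<in> k - Id" "j = l" | "i = j" "(j, l) \<in> k - Id"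
      | "(i, j) \<in> k - Id" "(j, l) \<in> k - Id"
      using ab bc by (auto simp: r_def)
    then have "(i, l) \<in> k - Id \<or> i = l \<and> (x, z) \<in> p i"
    proof cases
      case 1
      then show ?thesis using transD[OF pp(2)[OF F(3)]] by blast
    next
      case 4
      then have "(i, l) \<in> k" using transD[OF kk(2)] by blast
      moreover have "i \<noteq> l" using 4 antisymD[OF kk(3)] by blast
      ultimately show ?thesis by blast
    qed auto
    then show "(a, c) \<in> r" using F by (simp add: r_def)
  qed
  have 3: "antisym r"
  proof (rule antisymI)
    fix a b assume ab: "(a, b) \<in> r" and ba: "(b, a) \<in> r"
    obtain i x j y where [simp]: "a = (i, x)" "b = (j, y)"
      by (metis surj_pair)
    have i: "i \<in> I" using ab by (auto simp: r_def F_def)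
    have [simp]: "j = i" using ab ba antisymD[OF kk(3), of i j] by (auto simp: r_def)
    show "a = b" using ab ba antisymD[OF pp(3)[OF i], of x y] by (auto simp: r_def)
  qed
  have 4: "total_on (Field r) r"
    unfolding Fr
  proof (rule total_onI)
    fix a b assume ab: "a \<in> F" "b \<in> F" "a \<noteq> b"
    obtain i x j y where [simp]: "a = (i, x)" "b = (j, y)"
      by (metis surj_pair)
    have i: "i \<in> I" "j \<in> I" "x \<in> Field (p i)" "y \<in> Field (p j)"
      using ab by (auto simp: F_def)
    show "(a, b) \<in> r \<or> (b, a) \<in> r"
    proof (cases "i = j")
      case True
      then show ?thesis
        using ab i pp(4)[OF i(1)] by (simp add: r_def total_on_def)
    next
      case False
      then show ?thesis
        using ab i kk(4)[unfolded k(2)] by (simp add: r_def total_on_def)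
    qed
  qed
  have 5: "wf (r - Id)"
  proof (rule wfI_min)
    fix z :: "'k \<times> 'i" and Q assume z: "z \<in> Q"
    show "\<exists>z\<in>Q. \<forall>y. (y, z) \<in> r - Id \<longrightarrow> y \<notin> Q"
    proof (cases "Q \<inter> F = {}")
      case True
      then show ?thesis using z by (auto simp: r_def)
    next
      case False
      then have "fst ` (Q \<inter> F) \<noteq> {}" by blast
      then obtain i where i: "i \<in> fst ` (Q \<inter> F)"
        and imin: "\<And>j. (j, i) \<in> k - Id \<Longrightarrow> j \<notin> fst ` (Q \<inter> F)"
        using wfE_min[OF kk(5)] by (metis ex_in_conv)
      then have "i \<in> I" by (auto simp: F_def)
      from i obtain x0 where "x0 \<in> {x. (i, x) \<in> Q \<inter> F}" by force
      from wfE_min[OF pp(5)[OF \<open>i \<in> I\<close>] this]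
      obtain x where x: "(i, x) \<in> Q \<inter> F"
        and xmin: "\<And>y. (y, x) \<in> p i - Id \<Longrightarrow> (i, y) \<notin> Q \<inter> F"
        by (metis mem_Collect_eq)
      have "\<forall>y. (y, (i, x)) \<in> r - Id \<longrightarrow> y \<notin> Q"
        
      proof (intro allI impI notI)
        fix y assume y: "(y, (i, x)) \<in> r - Id" "y \<in> Q"
        obtain j u where [simp]: "y = (j, u)" by (metis surj_pair)
        have yF: "y \<in> Q \<inter> F" and c: "(j, i) \<in> k - Id \<or> j = i \<and> (u, x) \<in> p i - Id"
          using y by (auto simp: r_def)
        from c show False
        proof
          assume "(j, i) \<in> k - Id"
          with imin have "j \<notin> fst ` (Q \<inter> F)" by blast
          with yF show False by force
        next
          assume "j = i \<and> (u, x) \<in> p i - Id"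
          with xmin[of u] yF show False by simp
        qed
      qed
      then show ?thesis using x by blast
    qed
  qed
  have r: "Well_order r"
    using 1 2 3 4 5 unfolding order_on_defs well_order_on_def
    by (auto simp: Field_def)
  have "p i \<le>o r" if i: "i \<in> I" for i
  proof -
    let ?A = "Pair i ` Field (p i)"
    have "p i =o dir_image (p i) (Pair i)"
      using assms[OF i] by (auto intro!: dir_image_ordIso simp: inj_on_def)
    also have "dir_image (p i) (Pair i) = Restr r ?A"
      using i by (auto simp: dir_image_def r_def F_def Field_def)
    also have "Restr r ?A \<le>o r"
      using r by (rule Restr_ordLeq)
    finally show ?thesis .
  qed
  with r show ?thesis by blast
qed

lemma ord_sup_is_sup:
  fixes p :: "'k \<Rightarrow> 'i rel" and s :: "'j rel"
  assumes "\<And>i. i \<in> I \<Longrightarrow> Well_order (p i)"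
  shows "Well_order (ord_sup I p)" "i \<in> I \<Longrightarrow> p i \<le>o ord_sup I p"
    "Well_order s \<Longrightarrow> (\<And>i. i \<in> I \<Longrightarrow> p i \<le>o s) \<Longrightarrow> ord_sup I p \<le>o s"
proof -
  obtain r :: "('k \<times> 'i) rel" where r: "Well_order r" "\<forall>i\<in>I. p i \<le>o r"
    using upper_bound_exists[of I p] assms by blast
  show "Well_order (ord_sup I p)" "i \<in> I \<Longrightarrow> p i \<le>o ord_sup I p"
    using least_ord_props(1,2)[where P = "\<lambda>r. \<forall>i\<in>I. p i \<le>o r", OF r] unfolding ord_sup_def by auto
  show "ord_sup I p \<le>o s" if "Well_order s" "\<And>i. i \<in> I \<Longrightarrow> p i \<le>o s"
    unfolding ord_sup_def
    by (rule least_ord_le[where P = "\<lambda>r. \<forall>i\<in>I. p i \<le>o r", OF r that(1)]) (use that(2) ordLeq_ordIso_trans in blast)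
qed

end

theory Submission
  imports Defs
begin

text \<open>
  Upper bound: on a sum the Seeker can play the games of all summands simultaneously, since the
  union of open sets of the summands is open and every answer of the Hider restricts to an answer
  in each summand.  An infinite ordinal \<open>r\<close> leaves room for this along a copy of itself while
  \<open>|r|\<close> moves stay free; these are spent on unions of summands that pairwise separate the summands.

  Lower bound: the summands embed into the sum, and the plays determined by distinct points that
  the Hider keeps alive have distinct sequences of answers, so a space on which the Seeker wins
  in \<open>r\<close> moves has at most \<open>2\<^bsup>|r|\<^esup>\<close> points.
\<close>

subsection \<open>Plays with prescribed answers\<close>

lemma card_le_1_iff:
  "finite W \<and> card W \<le> 1 \<longleftrightarrow> (\<forall>x\<in>W. \<forall>y\<in>W. x = y)"
proof
  assume "finite W \<and> card W \<le> 1"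
  then show "\<forall>x\<in>W. \<forall>y\<in>W. x = y"
    by (metis One_nat_def card_le_Suc0_iff_eq)
next
  assume W: "\<forall>x\<in>W. \<forall>y\<in>W. x = y"
  then have "finite W"
    by (metis finite.emptyI finite_insert finite_subset insertI1 subsetI)
  with W show "finite W \<and> card W \<le> 1"
    by (metis One_nat_def card_le_Suc0_iff_eq)
qed

text \<open>A rule \<open>c\<close> for the Hider decides from the move and the set just offered; it
  serves both to keep a fixed point alive and to copy the answers of another play.\<close>

definition reply :: "'a topology \<Rightarrow> ('i \<Rightarrow> 'a set \<Rightarrow> bool) \<Rightarrow> 'i \<Rightarrow> 'a set \<Rightarrow> 'a set" where
  "reply X c b W = (if c b W then W else topspace X - W)"

text \<open>The Seeker's half of the play of \<open>\<sigma>\<close> against \<open>c\<close>. The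
  Hider's half is computed from it, so one recursion along \<open>r - Id\<close> yields the whole
  play.\<close>

definition seeker_moves ::
  "'i rel \<Rightarrow> 'a topology \<Rightarrow> ('i, 'a) strategy \<Rightarrow> ('i \<Rightarrow> 'a set \<Rightarrow> bool) \<Rightarrow> 'i \<Rightarrow> 'a set" where
  "seeker_moves r X \<sigma> c = wfrec (r - Id) (\<lambda>f a.
     \<sigma> a (restrict f (underS r a)) (restrict (\<lambda>b. reply X c b (f b)) (underS r a)))"

abbreviation hider_moves ::
  "'i rel \<Rightarrow> 'a topology \<Rightarrow> ('i, 'a) strategy \<Rightarrow> ('i \<Rightarrow> 'a set \<Rightarrow> bool) \<Rightarrow> 'i \<Rightarrow> 'a set" where
  "hider_moves r X \<sigma> c \<equiv> \<lambda>b. reply X c b (seeker_moves r X \<sigma> c b)"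

lemma underS_iff: "b \<in> underS r a \<longleftrightarrow> (b, a) \<in> r - Id"
  by (auto simp: underS_def)

lemma seeker_moves_eq:
  assumes "Well_order r"
  shows "seeker_moves r X \<sigma> c a =
    \<sigma> a (restrict (seeker_moves r X \<sigma> c) (underS r a)) (restrict (hider_moves r X \<sigma> c) (underS r a))"
proof -
  have wf: "wf (r - Id)"
    using assms by (simp add: well_order_on_def)
  let ?f = "seeker_moves r X \<sigma> c"
  have "restrict (cut ?f (r - Id) a) (underS r a) = restrict ?f (underS r a)"
    "restrict (\<lambda>b. reply X c b (cut ?f (r - Id) a b)) (underS r a)
      = restrict (\<lambda>b. reply X c b (?f b)) (underS r a)"
    by (auto intro!: restrict_ext simp: cut_def underS_iff)
  with wfrec[OF wf, of "\<lambda>f a. \<sigma> a (restrict f (underS r a))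
      (restrict (\<lambda>b. reply X c b (f b)) (underS r a))" a]
  show ?thesis
    unfolding seeker_moves_def by simp
qed

lemma play_of_seeker_moves:
  assumes "Well_order r"
  shows "play_of r X \<sigma> (seeker_moves r X \<sigma> c) (hider_moves r X \<sigma> c)"
  unfolding play_of_def
proof (intro ballI conjI)
  fix a
  show "seeker_moves r X \<sigma> c a = \<sigma> a (restrict (seeker_moves r X \<sigma> c) (underS r a))
      (restrict (hider_moves r X \<sigma> c) (underS r a))"
    by (rule seeker_moves_eq[OF assms])
  show "hider_moves r X \<sigma> c a \<in> {seeker_moves r X \<sigma> c a, topspace X - seeker_moves r X \<sigma> c a}"
    by (simp add: reply_def)
qed

text \<open>Only answers to sets actually offered before \<open>a\<close> influence the move at
  \<open>a\<close>, so agreement along the single play of \<open>c\<close> suffices. Transitivity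
  passes the hypothesis down to each earlier move.\<close>

lemma seeker_moves_cong:
  assumes r: "Well_order r"
    and eq: "\<And>b. b \<in> underS r a \<Longrightarrow> c b (seeker_moves r X \<sigma> c b) = c' b (seeker_moves r X \<sigma> c b)"
  shows "seeker_moves r X \<sigma> c a = seeker_moves r X \<sigma> c' a"
proof -
  have wf: "wf (r - Id)" and tr: "trans r" and an: "antisym r"
    using r by (auto simp: order_on_defs)
  show ?thesis
    using wf eq
  proof (induction a rule: wf_induct_rule)
    case (less a)
    have IH: "seeker_moves r X \<sigma> c b = seeker_moves r X \<sigma> c' b" if "b \<in> underS r a" for b
    proof (rule less.IH)
      show "(b, a) \<in> r - Id" using that by (simp add: underS_iff)
      fix d assume "d \<in> underS r b"
      then have "d \<in> underS r a"
        using that tr an unfolding underS_iff by (metis Diff_iff antisymD pair_in_Id_conv transD)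
      then show "c d (seeker_moves r X \<sigma> c d) = c' d (seeker_moves r X \<sigma> c d)"
        by (rule less.prems)
    qed
    have "restrict (seeker_moves r X \<sigma> c) (underS r a) = restrict (seeker_moves r X \<sigma> c') (underS r a)"
      "restrict (hider_moves r X \<sigma> c) (underS r a) = restrict (hider_moves r X \<sigma> c') (underS r a)"
      using IH less.prems by (auto intro!: restrict_ext simp: reply_def)
    then show ?case
      by (subst (1 2) seeker_moves_eq[OF r]) simp
  qed
qed

subsection \<open>Lower bounds\<close>

text \<open>For each point let the Hider always keep it, and record the moves whose offered set
  contains it. The record determines the play, so two points with equal records survive in the same
  outcome and coincide; recording is an injection into the subsets of
  \<open>Field r\<close>.\<close>

lemma card_topspace_le_Pow:
  assumes r: "Well_order r" and wins: "seeker_wins r X"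
  shows "|topspace X| \<le>o |Pow (Field r)|"
proof -
  obtain \<sigma> where
    win: "\<And>U V. play_of r X \<sigma> U V \<Longrightarrow> finite (outcome r X V) \<and> card (outcome r X V) \<le> 1"
    using wins unfolding seeker_wins_def by blast
  define P where "P p = seeker_moves r X \<sigma> (\<lambda>b W. p \<in> W)" for p
  define Q where "Q p = hider_moves r X \<sigma> (\<lambda>b W. p \<in> W)" for p
  have alive: "p \<in> outcome r X (Q p)" if "p \<in> topspace X" for p
    using that by (auto simp: outcome_def Q_def reply_def)
  have "p = q" if pq: "p \<in> topspace X" "q \<in> topspace X"
    and eq: "{a \<in> Field r. p \<in> P p a} = {a \<in> Field r. q \<in> P q a}" for p q
  proof -
    have wf: "wf (r - Id)" using r by (simp add: well_order_on_def)
    have iff: "p \<in> P p a \<longleftrightarrow> q \<in> P q a" if "a \<in> Field r" for a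
      using eq that by blast
    have P: "P p a = P q a" for a
      using wf
    proof (induction a rule: wf_induct_rule)
      case (less a)
      show ?case
        unfolding P_def
      proof (rule seeker_moves_cong[OF r])
        fix b assume "b \<in> underS r a"
        then have "b \<in> Field r" "(b, a) \<in> r - Id"
          by (auto simp: underS_def Field_def)
        \<comment> \<open>By induction both plays offer the same set at \<open>b\<close>, so equal
          records make both rules answer alike there.\<close>
        then have "p \<in> P p b \<longleftrightarrow> q \<in> P p b"
          using iff[of b] less.IH[of b] by simp
        then show "(p \<in> seeker_moves r X \<sigma> (\<lambda>b W. p \<in> W) b) = (q \<in> seeker_moves r X \<sigma> (\<lambda>b W. p \<in> W) b)"
          unfolding P_def .
      qed
    qed
    have "Q p a = Q q a" if "a \<in> Field r" for a
      using iff[OF that] P[of a] by (simp add: Q_def reply_def P_def[symmetric])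
    then have "outcome r X (Q p) = outcome r X (Q q)"
      by (simp add: outcome_def)
    moreover have "finite (outcome r X (Q p)) \<and> card (outcome r X (Q p)) \<le> 1"
      unfolding Q_def by (rule win[OF play_of_seeker_moves[OF r]])
    ultimately show "p = q"
      using alive[OF pq(1)] alive[OF pq(2)] unfolding card_le_1_iff by blast
  qed
  then have "inj_on (\<lambda>p. {a \<in> Field r. p \<in> P p a}) (topspace X)"
    by (auto intro: inj_onI)
  then show ?thesis
    by (rule card_of_ordLeqI) blast
qed

text \<open>The Seeker on \<open>X\<close> imagines a play on \<open>Y\<close>, offers the preimages
  of the sets moved there, and transfers the Hider's answers to \<open>Y\<close>. Then
  \<open>e\<close> maps the outcome on \<open>X\<close> into the outcome on
  \<open>Y\<close>.\<close>

lemma seeker_wins_continuous_inj: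
  fixes X :: "'a topology" and Y :: "'b topology" and r :: "'i rel"
  assumes r: "Well_order r" and wins: "seeker_wins r Y"
    and cont: "continuous_map X Y e" and inj: "inj_on e (topspace X)"
  shows "seeker_wins r X"
proof -
  obtain \<sigma> where \<sigma>: "seeker_strategy r Y \<sigma>" and
    win: "\<And>U V. play_of r Y \<sigma> U V \<Longrightarrow> finite (outcome r Y V) \<and> card (outcome r Y V) \<le> 1"
    using wins unfolding seeker_wins_def by blast
  define pre where "pre W = {x \<in> topspace X. e x \<in> W}" for W
  \<comment> \<open>Here \<open>V\<close> holds the Hider's answers on \<open>X\<close>; the
    imagined Hider keeps \<open>W\<close> exactly when the real answer was its preimage.\<close>
  define P where "P V = seeker_moves r Y \<sigma> (\<lambda>b W. V b = pre W)" for V :: "'i \<Rightarrow> 'a set"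
  define Q where "Q V = hider_moves r Y \<sigma> (\<lambda>b W. V b = pre W)" for V :: "'i \<Rightarrow> 'a set"
  define \<tau> :: "('i, 'a) strategy" where "\<tau> a U V = pre (P V a)" for a U V
  have etop: "e x \<in> topspace Y" if "x \<in> topspace X" for x
    using that cont continuous_map_image_subset_topspace by fastforce
  have "openin Y (P V a)" if "a \<in> Field r" for V a
    using \<sigma> that unfolding P_def seeker_moves_eq[OF r, of Y \<sigma> _ a] seeker_strategy_def by blast
  then have "seeker_strategy r X \<tau>"
    using cont by (auto simp: seeker_strategy_def \<tau>_def pre_def continuous_map_def)
  moreover have "finite (outcome r X V) \<and> card (outcome r X V) \<le> 1"
    if play: "play_of r X \<tau> U V" for U V
  proof -
    have U: "U a = pre (P V a)" and V: "V a = U a \<or> V a = topspace X - U a" if "a \<in> Field r" for a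
    proof -
      \<comment> \<open>The imagined move at \<open>a\<close> depends on \<open>V\<close> only
        through answers before \<open>a\<close>, so \<open>\<tau>\<close> recovers it from the
        truncated history.\<close>
      have "P (restrict V (underS r a)) a = P V a"
        unfolding P_def by (rule seeker_moves_cong[OF r]) simp
      then show "U a = pre (P V a)" "V a = U a \<or> V a = topspace X - U a"
        using play that unfolding play_of_def \<tau>_def by auto
    qed
    have "V a = pre (Q V a)" if "a \<in> Field r" for a
    proof (cases "V a = pre (P V a)")
      case True
      then show ?thesis by (simp add: Q_def reply_def P_def)
    next
      case False
      then have "V a = topspace X - pre (P V a)"
        using U[OF that] V[OF that] by auto
      also have "\<dots> = pre (topspace Y - P V a)"
        using etop by (auto simp: pre_def)
      also have "topspace Y - P V a = Q V a"
        using False by (simp add: Q_def reply_def P_def)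
      finally show ?thesis .
    qed
    then have sub: "e ` outcome r X V \<subseteq> outcome r Y (Q V)"
      using etop by (auto simp: outcome_def pre_def)
    have "finite (outcome r Y (Q V)) \<and> card (outcome r Y (Q V)) \<le> 1"
      unfolding Q_def by (rule win[OF play_of_seeker_moves[OF r]])
    then have "e x = e y" if "x \<in> outcome r X V" "y \<in> outcome r X V" for x y
      using sub that unfolding card_le_1_iff by blast
    moreover have "outcome r X V \<subseteq> topspace X"
      by (auto simp: outcome_def)
    ultimately show ?thesis
      using inj unfolding card_le_1_iff inj_on_def by blast
  qed
  ultimately show ?thesis
    unfolding seeker_wins_def by blast
qed

subsection \<open>Playing all summands simultaneously\<close>

lemma t0_space_sum_topology:
  assumes "\<And>i. i \<in> I \<Longrightarrow> t0_space (X i)"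
  shows "t0_space (sum_topology X I)"
  unfolding t0_space_def
proof (intro ballI impI)
  fix z w assume z: "z \<in> topspace (sum_topology X I)" and w: "w \<in> topspace (sum_topology X I)"
    and "z \<noteq> w"
  obtain i x j y where [simp]: "z = (i, x)" "w = (j, y)"
    by (metis surj_pair)
  have i: "i \<in> I" "x \<in> topspace (X i)" and j: "j \<in> I" "y \<in> topspace (X j)"
    using z w by auto
  have "\<exists>T. (\<forall>k\<in>I. openin (X k) (T k)) \<and> (x \<notin> T i \<longleftrightarrow> y \<in> T j)"
  proof (cases "i = j")
    case True
    then have "y \<in> topspace (X i)" "x \<noteq> y"
      using j \<open>z \<noteq> w\<close> by auto
    then obtain G where G: "openin (X i) G" "x \<notin> G \<longleftrightarrow> y \<in> G"
      using assms[OF i(1)] i(2) unfolding t0_space_def by blast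
    show ?thesis
      by (rule exI[of _ "\<lambda>k. if k = i then G else {}"]) (use G True in auto)
  next
    case False
    then show ?thesis
      by (intro exI[of _ "\<lambda>k. if k = i then topspace (X i) else {}"]) (use i in auto)
  qed
  then obtain T where T: "\<forall>k\<in>I. openin (X k) (T k)" "x \<notin> T i \<longleftrightarrow> y \<in> T j"
    by blast
  then have "openin (sum_topology X I) (Sigma I T)"
    by (simp add: openin_disjoint_union)
  with T(2) i j show "\<exists>U. openin (sum_topology X I) U \<and> (z \<notin> U \<longleftrightarrow> w \<in> U)"
    by (intro exI[of _ "Sigma I T"]) auto
qed

text \<open>At \<open>h i b\<close> the Seeker plays move \<open>b\<close> of the game on summand
  \<open>i\<close>, for all \<open>i\<close> at once; monotonicity makes the earlier moves of that
  game available in time. At a move \<open>a\<close> in \<open>A\<close> the Seeker offers the union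
  of the summands with \<open>a\<close> in \<open>S i\<close>, and since \<open>S\<close> is
  injective these moves leave a single summand.\<close>

lemma seeker_wins_sum_topology:
  fixes X :: "'k \<Rightarrow> 'a topology" and s :: "'k \<Rightarrow> 'i rel" and r :: "'j rel"
    and h :: "'k \<Rightarrow> 'i \<Rightarrow> 'j" and S :: "'k \<Rightarrow> 'j set"
  assumes s: "\<And>i. i \<in> I \<Longrightarrow> Well_order (s i)" "\<And>i. i \<in> I \<Longrightarrow> seeker_wins (s i) (X i)"
    and h: "\<And>i b. i \<in> I \<Longrightarrow> b \<in> Field (s i) \<Longrightarrow> h i b \<in> Field r - A"
    and mono: "\<And>i b c. i \<in> I \<Longrightarrow> c \<in> underS (s i) b \<Longrightarrow> h i c \<in> underS r (h i b)"
    and S: "inj_on S I" "\<And>i. i \<in> I \<Longrightarrow> S i \<subseteq> A" and A: "A \<subseteq> Field r"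
  shows "seeker_wins r (sum_topology X I)"
proof -
  define F where "F i = Field (s i)" for i
  have inj: "inj_on (h i) (F i)" if i: "i \<in> I" for i
  proof (rule inj_onI, rule ccontr)
    fix b c assume bc: "b \<in> F i" "c \<in> F i" "h i b = h i c" "b \<noteq> c"
    then have "b \<in> underS (s i) c \<or> c \<in> underS (s i) b"
      using s(1)[OF i] by (auto simp: F_def underS_def order_on_defs total_on_def)
    then show False
      using mono[OF i] bc(3) by (fastforce simp: underS_def)
  qed
  define g where "g i = inv_into (F i) (h i)" for i
  have g: "g i (h i b) = b" if "i \<in> I" "b \<in> F i" for i b
    using inv_into_f_f[OF inj] that by (simp add: g_def)
  have "\<exists>\<tau>. i \<in> I \<longrightarrow> seeker_strategy (s i) (X i) \<tau> \<and> (\<forall>U V. play_of (s i) (X i) \<tau> U V \<longrightarrow>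
      finite (outcome (s i) (X i) V) \<and> card (outcome (s i) (X i) V) \<le> 1)" for i
    using s(2) unfolding seeker_wins_def by blast
  then obtain \<tau> where \<tau>: "\<And>i. i \<in> I \<Longrightarrow> seeker_strategy (s i) (X i) (\<tau> i)"
    and win: "\<And>i U V. i \<in> I \<Longrightarrow> play_of (s i) (X i) (\<tau> i) U V \<Longrightarrow>
      finite (outcome (s i) (X i) V) \<and> card (outcome (s i) (X i) V) \<le> 1"
    by metis
  define slice where "slice i W = {x. (i, x) \<in> W}" for i :: 'k and W :: "('k \<times> 'a) set"
  define hist where "hist i U b = restrict (\<lambda>c. slice i (U (h i c))) (underS (s i) b)" for i U b
  \<comment> \<open>Since \<open>S i\<close> lies in \<open>A\<close>, a move outside both
    \<open>A\<close> and the range of \<open>h i\<close> contributes nothing in summand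
    \<open>i\<close>.\<close>
  define move where "move a U V i =
    (if a \<in> h i ` F i then \<tau> i (g i a) (hist i U (g i a)) (hist i V (g i a))
     else if a \<in> S i then topspace (X i) else {})" for a U V i
  define \<sigma> :: "('j, 'k \<times> 'a) strategy" where "\<sigma> a U V = Sigma I (move a U V)" for a U V
  let ?Y = "sum_topology X I"
  have "openin (X i) (move a U V i)" if "i \<in> I" for a U V i
    using \<tau>[OF that] g that by (auto simp: move_def seeker_strategy_def F_def)
  then have "seeker_strategy r ?Y \<sigma>"
    by (simp add: seeker_strategy_def \<sigma>_def openin_disjoint_union)
  moreover have "finite (outcome r ?Y V) \<and> card (outcome r ?Y V) \<le> 1"
    if play: "play_of r ?Y \<sigma> U V" for U V
    unfolding card_le_1_iff
  proof (intro ballI)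
    fix z w assume z: "z \<in> outcome r ?Y V" and w: "w \<in> outcome r ?Y V"
    obtain i x j y where [simp]: "z = (i, x)" "w = (j, y)"
      by (metis surj_pair)
    have i: "i \<in> I" "x \<in> topspace (X i)" and j: "j \<in> I" "y \<in> topspace (X j)"
      using z w by (auto simp: outcome_def)
    have zV: "(i, x) \<in> V a" and wV: "(j, y) \<in> V a" if "a \<in> Field r" for a
      using z w that by (auto simp: outcome_def)
    have U: "U a = Sigma I (move a (restrict U (underS r a)) (restrict V (underS r a)))"
      and V: "V a = U a \<or> V a = topspace ?Y - U a" if "a \<in> Field r" for a
      using play that unfolding play_of_def \<sigma>_def by blast+
    have "i = j"
    proof (rule ccontr)
      assume "i \<noteq> j"
      then have "S i \<noteq> S j"
        using S(1) i j by (meson inj_onD)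
      \<comment> \<open>The set offered at \<open>a\<close> contains exactly one of the summands
        \<open>i\<close> and \<open>j\<close>, because \<open>A\<close> avoids the ranges of
        \<open>h i\<close> and \<open>h j\<close>.\<close>
      then obtain a where a: "a \<in> S i \<longleftrightarrow> a \<notin> S j"
        by blast
      then have "a \<in> A"
        using S(2)[OF i(1)] S(2)[OF j(1)] by blast
      then have "a \<in> Field r" "a \<notin> h i ` F i" "a \<notin> h j ` F j"
        using A h i j by (auto simp: F_def)
      then show False
        using U[of a] V[of a] zV[of a] wV[of a] a i j by (auto simp: move_def)
    qed
    define U' where "U' = (\<lambda>b. slice i (U (h i b)))"
    define V' where "V' = (\<lambda>b. slice i (V (h i b)))"
    have "play_of (s i) (X i) (\<tau> i) U' V'"
      unfolding play_of_def
    proof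
      fix b assume b: "b \<in> Field (s i)"
      then have F: "h i b \<in> Field r" "b \<in> F i"
        using h[OF i(1)] by (auto simp: F_def)
      \<comment> \<open>The earlier moves of game \<open>i\<close> sit before \<open>h i b\<close>
        in \<open>r\<close>, so truncating the history there loses none of them.\<close>
      have "hist i (restrict T (underS r (h i b))) b = hist i T b" for T
        unfolding hist_def by (rule restrict_ext) (use mono[OF i(1)] in simp)
      then have "U' b = \<tau> i b (hist i U b) (hist i V b)"
        using U[OF F(1)] i F(2) by (simp add: U'_def slice_def move_def g)
      moreover have "hist i U b = restrict U' (underS (s i) b)"
        "hist i V b = restrict V' (underS (s i) b)"
        by (auto simp: hist_def U'_def V'_def)
      moreover have "V' b = U' b \<or> V' b = topspace (X i) - U' b"
      proof -
        have "slice i (topspace ?Y - W) = topspace (X i) - slice i W" for W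
          using i(1) by (auto simp: slice_def)
        then show ?thesis
          using V[OF F(1)] unfolding V'_def U'_def by metis
      qed
      ultimately show "U' b = \<tau> i b (restrict U' (underS (s i) b)) (restrict V' (underS (s i) b))
          \<and> V' b \<in> {U' b, topspace (X i) - U' b}"
        by simp
    qed
    from win[OF i(1) this]
    have "\<forall>p\<in>outcome (s i) (X i) V'. \<forall>q\<in>outcome (s i) (X i) V'. p = q"
      unfolding card_le_1_iff .
    moreover have "p \<in> outcome (s i) (X i) V'"
      if p: "p \<in> topspace (X i)" "\<And>a. a \<in> Field r \<Longrightarrow> (i, p) \<in> V a" for p
      unfolding outcome_def
    proof (intro IntI INT_I)
      fix b assume "b \<in> Field (s i)"
      then have "h i b \<in> Field r" using h[OF i(1)] by blast
      then show "p \<in> V' b" by (simp add: V'_def slice_def p(2))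
    qed (rule p)
    then have "x \<in> outcome (s i) (X i) V'" "y \<in> outcome (s i) (X i) V'"
      using i j zV wV \<open>i = j\<close> by simp_all
    ultimately show "z = w"
      using \<open>i = j\<close> by simp
  qed
  ultimately show ?thesis
    unfolding seeker_wins_def by blast
qed

subsection \<open>Copies of an infinite ordinal with large complement\<close>

lemma embed_underS_mem:
  assumes "Well_order r" "embed r r' f" "c \<in> underS r b"
  shows "f c \<in> underS r' (f b)"
proof -
  have "b \<in> Field r" "c \<in> Field r" "b \<noteq> c" "(c, b) \<in> r"
    using assms(3) by (auto simp: underS_def Field_def)
  then show ?thesis
    using embed_compat[OF assms(2)] embed_inj_on[OF assms(1,2)]
    by (auto simp: underS_def compat_def inj_on_def)
qed

text \<open>
  Only the initial segment \<open>C\<close> of \<open>r\<close> of order type \<open>|r|\<close> has to be thinned out: a subset of \<open>C\<close>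
  of full cardinality again contains a copy of the cardinal \<open>|r|\<close>.
\<close>

lemma infinite_Well_order_split:
  fixes r :: "'i rel"
  assumes r: "Well_order r" and inf: "infinite (Field r)"
  obtains h :: "'i \<Rightarrow> 'i" and A
  where "A \<subseteq> Field r" "|Field r| =o |A|" "\<And>b. b \<in> Field r \<Longrightarrow> h b \<in> Field r - A"
    "\<And>b c. c \<in> underS r b \<Longrightarrow> h c \<in> underS r (h b)"
proof -
  define k where "k = |Field r|"
  have k: "Well_order k" "Field k = Field r"
    unfolding k_def by (rule card_of_Well_order, rule Field_card_of)
  have "k \<le>o r"
    unfolding k_def by (rule card_of_least) (rule r)
  then obtain f where f: "embed k r f"
    by (auto simp: ordLeq_def)
  define C where "C = f ` Field r"
  have C: "C \<subseteq> Field r" "inj_on f (Field r)"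
    using embed_Field[OF f] embed_inj_on[OF k(1) f] by (auto simp: C_def k(2))
  have down: "c \<in> C" if "b \<in> C" "(c, b) \<in> r" for b c
    using embed_Field_ofilter[OF k(1) r f] that r
    by (auto simp: wo_rel.ofilter_def wo_rel_def C_def k(2) under_def)
  \<comment> \<open>As |r| + |r| = |r|, the segment \<open>C\<close> contains two disjoint sets of
    full cardinality: \<open>A\<close> stays free and \<open>B\<close> receives the copy of
    \<open>C\<close>.\<close>
  have "|Field r <+> Field r| =o |Field r|"
    using card_of_Plus_infinite1[OF inf card_of_mono1[OF subset_refl]] .
  moreover have "|Field r| =o |C|"
    using C(2) by (auto simp: C_def bij_betw_def simp flip: card_of_ordIso)
  ultimately have "|Field r <+> Field r| =o |C|"
    by (rule ordIso_transitive)
  then obtain \<phi> where \<phi>: "bij_betw \<phi> (Field r <+> Field r) C"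
    by (auto simp flip: card_of_ordIso)
  define A where "A = (\<lambda>x. \<phi> (Inl x)) ` Field r"
  define B where "B = (\<lambda>x. \<phi> (Inr x)) ` Field r"
  have AB: "A \<subseteq> C" "B \<subseteq> C" "A \<inter> B = {}"
    using \<phi> by (auto simp: A_def B_def bij_betw_def dest: inj_onD)
  have "inj_on (\<lambda>x. \<phi> (Inl x)) (Field r)" "inj_on (\<lambda>x. \<phi> (Inr x)) (Field r)"
    using \<phi> by (auto simp: bij_betw_def inj_on_def)
  then have card: "|Field r| =o |A|" "|Field r| =o |B|"
    by (auto simp: A_def B_def bij_betw_def simp flip: card_of_ordIso)
  have FB: "Field (Restr r B) = B"
    using AB(2) C(1) r by (intro Refl_Field_Restr2) (auto simp: order_on_defs)
  \<comment> \<open>The induced order on \<open>B\<close> is a well-order of cardinality |r|, so the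
    least such well-order, \<open>k\<close>, embeds into it.\<close>
  have "|B| \<le>o Restr r B"
    using card_of_least[OF Well_order_Restr[OF r], of B] FB by simp
  then have "k \<le>o Restr r B"
    using card(2) ordIso_ordLeq_trans unfolding k_def by blast
  then obtain e where e: "embed k (Restr r B) e"
    by (auto simp: ordLeq_def)
  have eB: "e x \<in> B" if "x \<in> Field r" for x
    using embed_in_Field[OF e] that by (simp add: k(2) FB)
  define p where "p = inv_into (Field r) f"
  have p: "p b \<in> Field r" "f (p b) = b" if "b \<in> C" for b
    using that by (auto simp: p_def C_def inv_into_into f_inv_into_f)
  \<comment> \<open>On \<open>C\<close> the map passes back to \<open>k\<close> and then into
    \<open>B\<close>; outside \<open>C\<close> nothing has to move.\<close>
  define h where "h b = (if b \<in> C then e (p b) else b)" for b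
  have "A \<subseteq> Field r"
    using AB C by blast
  moreover have "h b \<in> Field r - A" if "b \<in> Field r" for b
    using that eB[OF p(1)[of b]] AB C(1) by (auto simp: h_def)
  moreover have "h c \<in> underS r (h b)" if cb: "c \<in> underS r b" for b c
  proof -
    have F: "b \<in> Field r" "c \<in> Field r" "c \<noteq> b" "(c, b) \<in> r"
      using cb by (auto simp: underS_def Field_def)
    \<comment> \<open>The remaining combination, \<open>b\<close> in \<open>C\<close> and
      \<open>c\<close> outside, is excluded because \<open>C\<close> is an initial segment.\<close>
    consider "b \<in> C" "c \<in> C" | "b \<notin> C" "c \<in> C" | "b \<notin> C" "c \<notin> C"
      using down F(4) by blast
    then show ?thesis
    proof cases
      case 1
      have "p c \<noteq> p b"
        using F(3) p(2) 1 by metis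
      moreover have "(p c, p b) \<in> k"
      proof (rule ccontr)
        assume "(p c, p b) \<notin> k"
        then have "(p b, p c) \<in> k"
          using k p(1)[OF 1(1)] p(1)[OF 1(2)] \<open>p c \<noteq> p b\<close>
          by (auto simp: order_on_defs total_on_def)
        then have "(b, c) \<in> r"
          using embed_compat[OF f] p(2)[OF 1(1)] p(2)[OF 1(2)] by (metis compat_def)
        then show False
          using F r by (auto simp: order_on_defs antisym_def)
      qed
      ultimately have "e (p c) \<in> underS (Restr r B) (e (p b))"
        by (intro embed_underS_mem[OF k(1) e]) (simp add: underS_def)
      then show ?thesis
        using 1 by (auto simp: h_def underS_def)
    next
      case 2
      have hc: "h c \<in> C"
        using 2 eB[OF p(1)[of c]] AB by (auto simp: h_def)
      \<comment> \<open>Although \<open>h\<close> may move \<open>c\<close> upwards, it stays in the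
        initial segment \<open>C\<close> and hence below \<open>b\<close>.\<close>
      moreover have "(b, h c) \<notin> r"
        using down hc 2(1) by blast
      moreover have "h c \<noteq> b"
        using hc 2(1) by blast
      ultimately have "(h c, b) \<in> r"
        using F(1) C(1) r by (auto simp: order_on_defs total_on_def)
      then show ?thesis
        using \<open>h c \<noteq> b\<close> 2 by (simp add: h_def underS_def)
    next
      case 3
      then show ?thesis using cb by (simp add: h_def)
    qed
  qed
  ultimately show ?thesis
    using that card(1) by blast
qed

subsection \<open>The point separation number of a sum\<close>

lemma Pow_ordIso_ctwo_cexp: "|Pow A| =o ctwo ^c |A|"
  unfolding ctwo_def cexp_def Field_card_of by (rule card_of_Pow_Func)

lemma Pow_ordLeq_Pow:
  assumes "|A| \<le>o |B|"
  shows "|Pow A| \<le>o |Pow B|"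
proof -
  obtain f where "inj_on f A" "f ` A \<subseteq> B"
    using assms by (auto simp flip: card_of_ordLeq)
  then show ?thesis
    by (intro card_of_ordLeqI[of "image f"]) (auto intro: inj_on_image_Pow)
qed

text \<open>The free set \<open>A\<close> has cardinality |r|, which is at least log(\<kappa>), so
  its subsets suffice to label the summands injectively. Each \<open>ps (X i)\<close> embeds into
  \<open>r\<close>, and following with \<open>h\<close> moves its game off \<open>A\<close>.\<close>

lemma ps_sum_topology_le:
  fixes \<kappa> :: "'k rel" and X :: "'k \<Rightarrow> 'a topology" and r :: "'j rel"
  assumes \<kappa>: "Card_order \<kappa>" and t0: "\<And>i. i \<in> Field \<kappa> \<Longrightarrow> t0_space (X i)"
    and r: "Well_order r" "infinite (Field r)"
    and log: "card_log \<kappa> \<le>o r" and ps: "\<And>i. i \<in> Field \<kappa> \<Longrightarrow> ps (X i) \<le>o r"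
  shows "ps (sum_topology X (Field \<kappa>)) \<le>o r"
proof -
  obtain h :: "'j \<Rightarrow> 'j" and A where A: "A \<subseteq> Field r" "|Field r| =o |A|"
    and h: "\<And>b. b \<in> Field r \<Longrightarrow> h b \<in> Field r - A"
      "\<And>b c. c \<in> underS r b \<Longrightarrow> h c \<in> underS r (h b)"
    by (rule infinite_Well_order_split[OF r]) (rule that)
  define l where "l = card_log \<kappa>"
  have l: "Card_order l" "\<kappa> \<le>o ctwo ^c l"
    using card_log_is_min(1,2)[OF \<kappa>] by (simp_all add: l_def)
  have "|Field \<kappa>| =o \<kappa>"
    using \<kappa> by (rule card_of_Field_ordIso)
  also have "\<kappa> \<le>o ctwo ^c l"
    by (rule l)
  also have "ctwo ^c l =o |Pow (Field l)|"
    using card_of_Pow_Func ordIso_symmetric unfolding ctwo_def cexp_def Field_card_of by blast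
  also have "|Pow (Field l)| \<le>o |Pow A|"
  proof (rule Pow_ordLeq_Pow)
    have "|Field l| \<le>o |Field r|"
      using log unfolding l_def by (rule card_of_mono2)
    then show "|Field l| \<le>o |A|"
      using A(2) by (rule ordLeq_ordIso_trans)
  qed
  finally obtain S where S: "inj_on S (Field \<kappa>)" "S ` Field \<kappa> \<subseteq> Pow A"
    by (auto simp flip: card_of_ordLeq)
  have "\<exists>f. i \<in> Field \<kappa> \<longrightarrow> embed (ps (X i)) r f" for i
    using ps[of i] by (auto simp: ordLeq_def)
  then obtain f where f: "\<And>i. i \<in> Field \<kappa> \<Longrightarrow> embed (ps (X i)) r (f i)"
    by metis
  have "seeker_wins r (sum_topology X (Field \<kappa>))"
  proof (rule seeker_wins_sum_topology)
    fix i assume i: "i \<in> Field \<kappa>"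
    show "Well_order (ps (X i))" "seeker_wins (ps (X i)) (X i)"
      using ps_wins t0[OF i] by auto
    show "h (f i b) \<in> Field r - A" if "b \<in> Field (ps (X i))" for b
      using embed_in_Field[OF f[OF i] that] by (rule h(1))
    show "h (f i c) \<in> underS r (h (f i b))" if "c \<in> underS (ps (X i)) b" for b c
      using embed_underS_mem[OF ps_wins(1)[OF t0[OF i]] f[OF i] that] by (rule h(2))
    show "S i \<subseteq> A"
      using S(2) i by blast
  qed (use S(1) A(1) in auto)
  with t0 r(1) show ?thesis
    by (intro ps_least t0_space_sum_topology)
qed

lemma ps_le_ps_sum_topology:
  assumes t0: "\<And>i. i \<in> I \<Longrightarrow> t0_space (X i)" and i: "i \<in> I"
  shows "ps (X i) \<le>o ps (sum_topology X I)"
proof (rule ps_least)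
  have sum: "Well_order (ps (sum_topology X I))"
    "seeker_wins (ps (sum_topology X I)) (sum_topology X I)"
    using ps_wins[OF t0_space_sum_topology[of I X], OF t0] by simp_all
  show "t0_space (X i)" "Well_order (ps (sum_topology X I))"
    using t0[OF i] sum(1) by auto
  have "continuous_map (X i) (sum_topology X I) (\<lambda>x. (i, x))"
    using continuous_map_component_injection[OF i] .
  then show "seeker_wins (ps (sum_topology X I)) (X i)"
    by (rule seeker_wins_continuous_inj[OF sum]) (simp add: inj_on_def)
qed

text \<open>One point from each summand gives at least \<kappa> points in the sum, and these inject
  into the subsets of the game length.\<close>

lemma card_log_le_ps_sum_topology:
  fixes \<kappa> :: "'k rel" and X :: "'k \<Rightarrow> 'a topology"
  assumes \<kappa>: "Card_order \<kappa>" and t0: "\<And>i. i \<in> Field \<kappa> \<Longrightarrow> t0_space (X i)"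
    and ne: "\<And>i. i \<in> Field \<kappa> \<Longrightarrow> topspace (X i) \<noteq> {}"
  shows "card_log \<kappa> \<le>o ps (sum_topology X (Field \<kappa>))"
proof -
  define Y where "Y = sum_topology X (Field \<kappa>)"
  have Y: "Well_order (ps Y)" "seeker_wins (ps Y) Y"
    using ps_wins[OF t0_space_sum_topology[of "Field \<kappa>" X], OF t0] by (simp_all add: Y_def)
  have "\<forall>i\<in>Field \<kappa>. \<exists>x. x \<in> topspace (X i)"
    using ne by blast
  then obtain pt where "\<forall>i\<in>Field \<kappa>. pt i \<in> topspace (X i)"
    by (rule bchoice[THEN exE])
  then have "|Field \<kappa>| \<le>o |topspace Y|"
    by (intro card_of_ordLeqI[of "\<lambda>i. (i, pt i)"]) (auto simp: Y_def inj_on_def)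
  also have "|topspace Y| \<le>o |Pow (Field (ps Y))|"
    by (rule card_topspace_le_Pow[OF Y])
  also have "|Pow (Field (ps Y))| =o ctwo ^c |Field (ps Y)|"
    by (rule Pow_ordIso_ctwo_cexp)
  finally have "|Field \<kappa>| \<le>o ctwo ^c |Field (ps Y)|" .
  then have "\<kappa> \<le>o ctwo ^c |Field (ps Y)|"
    using card_of_Field_ordIso[OF \<kappa>] ordIso_ordLeq_trans ordIso_symmetric by blast
  \<comment> \<open>Minimality of the logarithm is among cardinals, so the bound goes through the
    cardinality of \<open>ps Y\<close>, which is at most the ordinal itself.\<close>
  then have "card_log \<kappa> \<le>o |Field (ps Y)|"
    by (rule card_log_is_min(3)[OF \<kappa> card_of_Card_order])
  also have "|Field (ps Y)| \<le>o ps Y"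
    using Y(1) by (rule card_of_least)
  finally show ?thesis
    unfolding Y_def .
qed

theorem theorem3p1:
  fixes \<kappa> :: "'k rel" and X :: "'k \<Rightarrow> 'a topology"
  assumes "Card_order \<kappa>"
    and "\<And>\<alpha>. \<alpha> \<in> Field \<kappa> \<Longrightarrow> t0_space (X \<alpha>)"
    and "\<And>\<alpha>. \<alpha> \<in> Field \<kappa> \<Longrightarrow> topspace (X \<alpha>) \<noteq> {}"
    and "infinite (Field (ord_max (card_log \<kappa>) (ord_sup (Field \<kappa>) (\<lambda>\<alpha>. ps (X \<alpha>)))))"
  shows "ps (sum_topology X (Field \<kappa>)) =o
         ord_max (card_log \<kappa>) (ord_sup (Field \<kappa>) (\<lambda>\<alpha>. ps (X \<alpha>)))"
proof -
  define l where "l = card_log \<kappa>"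
  define s where "s = ord_sup (Field \<kappa>) (\<lambda>\<alpha>. ps (X \<alpha>))"
  define Y where "Y = sum_topology X (Field \<kappa>)"
  have l: "Well_order l"
    using card_log_is_min(1)[OF assms(1)] unfolding l_def by (rule card_order_on_well_order_on)
  have wo: "\<And>\<alpha>. \<alpha> \<in> Field \<kappa> \<Longrightarrow> Well_order (ps (X \<alpha>))" and Y: "Well_order (ps Y)"
    using ps_wins(1) assms(2) t0_space_sum_topology[of "Field \<kappa>" X] by (auto simp: Y_def)
  have s: "Well_order s" "\<And>\<alpha>. \<alpha> \<in> Field \<kappa> \<Longrightarrow> ps (X \<alpha>) \<le>o s" "s \<le>o ps Y"
    using ord_sup_is_sup[of "Field \<kappa>" "\<lambda>\<alpha>. ps (X \<alpha>)", OF wo] Y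
      ps_le_ps_sum_topology[of "Field \<kappa>" X, OF assms(2)]
    unfolding s_def Y_def by auto
  have lY: "l \<le>o ps Y"
    unfolding l_def Y_def by (rule card_log_le_ps_sum_topology[OF assms(1-3)])
  note max = ord_max_props[OF l s(1)]
  \<comment> \<open>Up to isomorphism the maximum is \<open>l\<close> or \<open>s\<close>, so it
    inherits the bound by \<open>ps Y\<close> that holds for both.\<close>
  have m: "Well_order (ord_max l s) \<and> l \<le>o ord_max l s \<and> s \<le>o ord_max l s \<and> ord_max l s \<le>o ps Y"
  proof (cases "l \<le>o s")
    case True
    then have eq: "ord_max l s =o s" by (rule max(1))
    with True s(3) show ?thesis
      using ordLeq_ordIso_trans[OF _ ordIso_symmetric[OF eq]] ordIso_ordLeq_trans[OF eq]
        ordIso_imp_ordLeq[OF ordIso_symmetric[OF eq]] by (auto simp: ordIso_def)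
  next
    case False
    then have le: "s \<le>o l" using l s(1) ordLeq_total by blast
    then have eq: "ord_max l s =o l" by (rule max(2))
    with le lY show ?thesis
      using ordLeq_ordIso_trans[OF _ ordIso_symmetric[OF eq]] ordIso_ordLeq_trans[OF eq]
        ordIso_imp_ordLeq[OF ordIso_symmetric[OF eq]] by (auto simp: ordIso_def)
  qed
  have "ps Y \<le>o ord_max l s"
    unfolding Y_def
  proof (rule ps_sum_topology_le[OF assms(1,2)])
    show "Well_order (ord_max l s)"
      using m by blast
    show "infinite (Field (ord_max l s))"
      using assms(4) by (simp add: l_def s_def)
    show "card_log \<kappa> \<le>o ord_max l s"
      using m by (simp add: l_def)
    show "ps (X i) \<le>o ord_max l s" if "i \<in> Field \<kappa>" for i
      using s(2)[OF that] m[THEN conjunct2, THEN conjunct2, THEN conjunct1] by (rule ordLeq_transitive)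
  qed
  with m show ?thesis
    unfolding ordIso_iff_ordLeq l_def s_def Y_def by blast
qed

end
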